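(* Let $C=(c_{mn})_{m,n\ge 0}$ be a diagonal matrix such that $c_{nn}\ge 0$ for all $n$ and $\sum_{n=0}^\infty c_{nn}r^n<+\infty$ for every $0<r<1$. Let $\mu$ be a Borel probability measure on $[0,1)$ and let $M=(\widehat{\mu}(n-m))_{m,n\ge 0}$. Then the following hold: (1) for every $w\in\mathbb{D}$, the series $\sum_{n=0}^{\infty}c_{nn}\overline{w}^n e^{2\pi i n x}$ converges in $L^2(\mu)$; (2) $CMC$ is defined in the matrix sense; (3) $K_{C}(w,z)=\sum_{n}\sum_m c_{mn}\overline{w}^m z^n$ reproduces itself with respect to $L^2(\mu)$-boundaries if and only if the equation $C=CMC$ holds.
   Context: $\mathbb{D}$ is the open unit disc. $\widehat{\mu}(n)=\int_0^1 e^{-2\pi i n x}\,d\mu(x)$. For two matrices $A=(a_{mn})_{m,n\ge0}$ and $B=(b_{mn})_{m,n\ge 0}$, $AB$ is \emph{defined in the matrix sense} if for every $m,n\ge 0$ the sum $\sum_{k=0}^\infty a_{mk}b_{kn}$ converges. $ABD$ is defined in the matrix sense if $AB$, $BD$, $(AB)D$, $A(BD)$ are all defined in the matrix sense and $(AB)D=A(BD)$. For a finite Borel measure $\mu$ on $[0,1)$ and an analytic function $f$ on $\mathbb{D}$, an $L^2(\mu)$-boundary of $f$ is a function $f^\star\in L^2(\mu)$ with $\lim_{r\to1^-}\|f^\star(x)-f(re^{2\pi i x})\|_{L^2(\mu)}=0$ (it is unique if it exists). A kernel $K:\mathbb{D}\times\mathbb{D}\to\mathbb{C}$, analytic in its second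 variable, reproduces itself with respect to $L^2(\mu)$-boundaries if for each $w\in\mathbb{D}$ the function $K(w,\cdot)$ possesses an $L^2(\mu)$-boundary $K^\star(w,\cdot)$ and $K(w,z)=\int_0^1 K^\star(w,x)\overline{K^\star(z,x)}\,d\mu(x)$ for all $w,z\in\mathbb{D}$. *)

theory Defs
  imports "HOL-Probability.Probability"
begin

definition L2_space :: "real measure \<Rightarrow> (real \<Rightarrow> complex) set" where
  "L2_space \<mu> = {f \<in> borel_measurable \<mu>. integrable \<mu> (\<lambda>x. (cmod (f x))\<^sup>2)}"

text \<open>The Bochner integral of a non-integrable function is 0, so this is a norm only
  on \<open>L2_space \<mu>\<close>; for a finite measure on \<open>[0,1)\<close> every use below is on that space.\<close>

definition L2_norm :: "real measure \<Rightarrow> (real \<Rightarrow> complex) \<Rightarrow> real" where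
  "L2_norm \<mu> f = sqrt (LINT x|\<mu>. (cmod (f x))\<^sup>2)"

definition L2_summable :: "real measure \<Rightarrow> (nat \<Rightarrow> real \<Rightarrow> complex) \<Rightarrow> bool" where
  "L2_summable \<mu> u \<longleftrightarrow>
     (\<forall>n. u n \<in> L2_space \<mu>) \<and>
     (\<exists>g \<in> L2_space \<mu>. (\<lambda>N. L2_norm \<mu> (\<lambda>x. g x - (\<Sum>n<N. u n x))) \<longlonglongrightarrow> 0)"

definition fourier_coeff :: "real measure \<Rightarrow> int \<Rightarrow> complex" where
  "fourier_coeff \<mu> n = (LINT x|\<mu>. cis (- 2 * pi * of_int n * x))"

definition fourier_matrix :: "real measure \<Rightarrow> nat \<Rightarrow> nat \<Rightarrow> complex" where
  "fourier_matrix \<mu> m n = fourier_coeff \<mu> (int n - int m)"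

type_synonym inf_matrix = "nat \<Rightarrow> nat \<Rightarrow> complex"

definition diagonal_matrix :: "inf_matrix \<Rightarrow> bool" where
  "diagonal_matrix A \<longleftrightarrow> (\<forall>m n. m \<noteq> n \<longrightarrow> A m n = 0)"

definition matrix_prod :: "inf_matrix \<Rightarrow> inf_matrix \<Rightarrow> inf_matrix" where
  "matrix_prod A B = (\<lambda>m n. \<Sum>k. A m k * B k n)"

definition prod_defined :: "inf_matrix \<Rightarrow> inf_matrix \<Rightarrow> bool" where
  "prod_defined A B \<longleftrightarrow> (\<forall>m n. summable (\<lambda>k. A m k * B k n))"

definition triple_prod_defined :: "inf_matrix \<Rightarrow> inf_matrix \<Rightarrow> inf_matrix \<Rightarrow> bool" where
  "triple_prod_defined A B D \<longleftrightarrow>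
     prod_defined A B \<and> prod_defined B D \<and>
     prod_defined (matrix_prod A B) D \<and> prod_defined A (matrix_prod B D) \<and>
     matrix_prod (matrix_prod A B) D = matrix_prod A (matrix_prod B D)"

text \<open>For \<open>r < 1\<close> and a finite measure on \<open>[0,1)\<close>, \<open>x \<mapsto> f (r e\<^sup>2\<^sup>\<pi>\<^sup>i\<^sup>x)\<close> is bounded and
  continuous, hence square-integrable.\<close>

definition is_L2_boundary ::
    "real measure \<Rightarrow> (complex \<Rightarrow> complex) \<Rightarrow> (real \<Rightarrow> complex) \<Rightarrow> bool" where
  "is_L2_boundary \<mu> f fs \<longleftrightarrow>
     f holomorphic_on ball 0 1 \<and> fs \<in> L2_space \<mu> \<and>
     ((\<lambda>r. L2_norm \<mu> (\<lambda>x. fs x - f (complex_of_real r * cis (2 * pi * x)))) \<longlongrightarrow> 0) (at_left 1)"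

text \<open>The boundary functions are unique up to \<open>\<mu>\<close>-null sets, which do not affect the
  integral, so quantifying existentially over the family \<open>Ks\<close> is harmless.\<close>

definition reproduces_itself ::
    "real measure \<Rightarrow> (complex \<Rightarrow> complex \<Rightarrow> complex) \<Rightarrow> bool" where
  "reproduces_itself \<mu> K \<longleftrightarrow>
     (\<exists>Ks :: complex \<Rightarrow> real \<Rightarrow> complex.
        (\<forall>w \<in> ball 0 1. is_L2_boundary \<mu> (K w) (Ks w)) \<and>
        (\<forall>w \<in> ball 0 1. \<forall>z \<in> ball 0 1. K w z = (LINT x|\<mu>. Ks w x * cnj (Ks z x))))"

definition matrix_kernel :: "inf_matrix \<Rightarrow> complex \<Rightarrow> complex \<Rightarrow> complex" where
  "matrix_kernel A w z = (\<Sum>n. \<Sum>m. A m n * cnj w ^ m * z ^ n)"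

end

theory Submission
  imports Defs
begin

text \<open>Write \<open>k(u) = \<Sum>\<^sub>n c\<^sub>n\<^sub>n u\<^sup>n\<close>, so that \<open>K\<^sub>C(w,z) = k(w\<^sup>* z)\<close>, with \<open>w\<^sup>*\<close> the conjugate of
  \<open>w\<close>. For fixed \<open>w\<close> in the disc, \<open>k\<close> is
  uniformly continuous on the closed disc of radius \<open>|w|\<close>; hence \<open>K\<^sub>C(w,\<cdot>)\<close> extends continuously to
  the unit circle, and \<open>x \<mapsto> k(w\<^sup>* e\<^sup>2\<^sup>\<pi>\<^sup>i\<^sup>x)\<close> is, up to null sets, its only \<open>L\<^sup>2(\<mu>)\<close>-boundary. Integrating
  the absolutely convergent series term by term shows that the inner product of the
  boundaries of \<open>K\<^sub>C(w,\<cdot>)\<close> and \<open>K\<^sub>C(z,\<cdot>)\<close> is the kernel of the matrix \<open>CMC\<close>, and a kernel determines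
  its matrix by uniqueness of power series coefficients, applied in \<open>z\<close> and then in \<open>w\<^sup>*\<close>.\<close>

subsection \<open>Power series\<close>

text \<open>Convergence at the point \<open>r/2\<close> makes both radii of convergence positive,
  and a formal power series with positive radius is determined by its values near 0. This extracts
  matrix entries from kernels, one variable at a time.\<close>

lemma powser_coeff_unique:
  fixes a b :: "nat \<Rightarrow> complex"
  assumes r: "0 < r"
    and a: "\<And>z. norm z < r \<Longrightarrow> (\<lambda>n. a n * z ^ n) sums f z"
    and b: "\<And>z. norm z < r \<Longrightarrow> (\<lambda>n. b n * z ^ n) sums f z"
  shows "a = b"
proof -
  have rad: "0 < conv_radius c" if c: "\<And>z. norm z < r \<Longrightarrow> (\<lambda>n. c n * z ^ n) sums f z" for c
  proof -
    have "ereal (norm (complex_of_real (r/2))) \<le> conv_radius c"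
      using r by (intro conv_radius_geI sums_summable[OF c]) auto
    moreover have "0 < ereal (norm (complex_of_real (r/2)))" using r by simp
    ultimately show ?thesis by (rule less_le_trans[rotated])
  qed
  have "\<forall>\<^sub>F z in nhds 0. z \<in> ball (0::complex) r"
    using r by (intro eventually_nhds_in_open) auto
  then have "\<forall>\<^sub>F z in nhds 0. eval_fps (Abs_fps a) z = eval_fps (Abs_fps b) z"
    by eventually_elim (use a b in \<open>auto simp: eval_fps_def sums_iff\<close>)
  then have "Abs_fps a = Abs_fps b"
    using rad[OF a] rad[OF b] by (intro eval_fps_eqD) (auto simp: fps_conv_radius_def)
  then show ?thesis by (simp add: fps_eq_iff fun_eq_iff)
qed

text \<open>The closed disc of radius |u| is compact and lies inside the disc of convergence, so
  \<open>eval_fps F\<close> is uniformly continuous there. Both arguments stay in that disc, at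
  distance at most |u| |r - 1|, a bound independent of x.\<close>

lemma uniform_limit_eval_fps_radial:
  fixes F :: "complex fps"
  assumes u: "norm u < fps_conv_radius F" and \<phi>: "\<And>x. x \<in> X \<Longrightarrow> norm (\<phi> x) \<le> 1"
  shows "uniform_limit X (\<lambda>r x. eval_fps F (u * (of_real r * \<phi> x)))
           (\<lambda>x. eval_fps F (u * \<phi> x)) (at_left (1::real))"
proof (rule uniform_limitI)
  fix e :: real assume e: "0 < e"
  have "cball (0::complex) (norm u) \<subseteq> eball 0 (fps_conv_radius F)"
  proof
    fix v :: complex assume "v \<in> cball 0 (norm u)"
    then have "ereal (norm v) \<le> ereal (norm u)" by simp
    from this u have "ereal (norm v) < fps_conv_radius F" by (rule le_less_trans)
    then show "v \<in> eball 0 (fps_conv_radius F)" by (simp add: in_eball_iff)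
  qed
  then have "continuous_on (cball 0 (norm u)) (eval_fps F)"
    by (intro continuous_on_subset[OF continuous_on_eval_fps])
  then have "uniformly_continuous_on (cball 0 (norm u)) (eval_fps F)"
    by (intro compact_uniformly_continuous) auto
  then obtain d where d: "0 < d" and
    D: "\<And>x y. x \<in> cball 0 (norm u) \<Longrightarrow> y \<in> cball 0 (norm u) \<Longrightarrow> dist y x < d \<Longrightarrow>
          dist (eval_fps F y) (eval_fps F x) < e"
    using e unfolding uniformly_continuous_on_def by blast
  have "((\<lambda>r. norm u * \<bar>r - 1\<bar>) \<longlongrightarrow> norm u * \<bar>1 - 1\<bar>) (at_left (1::real))"
    by (intro tendsto_intros)
  then have "\<forall>\<^sub>F r in at_left (1::real). norm u * \<bar>r - 1\<bar> < d"
    using d by (intro order_tendstoD(2)[where y="norm u * \<bar>1 - 1\<bar>"]) auto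
  moreover have "\<forall>\<^sub>F r in at_left (1::real). r \<in> {0<..<1}"
    by (rule eventually_at_left_real) auto
  ultimately show "\<forall>\<^sub>F r in at_left 1. \<forall>x\<in>X.
      dist (eval_fps F (u * (of_real r * \<phi> x))) (eval_fps F (u * \<phi> x)) < e"
  proof eventually_elim
    case (elim r)
    show ?case
    proof
      fix x assume x: "x \<in> X"
      have "norm (u * \<phi> x) \<le> norm u * 1"
        unfolding norm_mult by (intro mult_left_mono \<phi> x) auto
      moreover have "norm (u * (of_real r * \<phi> x)) \<le> norm u * (1 * 1)"
        unfolding norm_mult using elim by (intro mult_left_mono mult_mono \<phi> x) auto
      moreover have "dist (u * (of_real r * \<phi> x)) (u * \<phi> x) < d"
      proof -
        have "u * (of_real r * \<phi> x) - u * \<phi> x = u * of_real (r - 1) * \<phi> x"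
          by (simp add: algebra_simps)
        then have "dist (u * (of_real r * \<phi> x)) (u * \<phi> x) = norm u * \<bar>r - 1\<bar> * norm (\<phi> x)"
          by (simp add: dist_norm norm_mult del: of_real_diff)
        also have "\<dots> \<le> norm u * \<bar>r - 1\<bar> * 1"
          by (intro mult_left_mono \<phi> x) auto
        finally show ?thesis using elim by simp
      qed
      ultimately show "dist (eval_fps F (u * (of_real r * \<phi> x))) (eval_fps F (u * \<phi> x)) < e"
        by (intro D) auto
    qed
  qed
qed

text \<open>The majorant depends on u alone. It bounds boundary functions on the whole circle, both
  for square-integrability and for integration term by term.\<close>

lemma norm_eval_fps_le:
  fixes F :: "complex fps"
  assumes u: "norm u < fps_conv_radius F" and v: "norm v \<le> norm u"
  shows "norm (eval_fps F v) \<le> (\<Sum>n. norm (fps_nth F n * u ^ n))"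
proof -
  have S: "summable (\<lambda>n. norm (fps_nth F n * w ^ n))" if "norm w \<le> norm u" for w
    using that u by (intro abs_summable_in_conv_radius)
      (auto simp: fps_conv_radius_def intro: le_less_trans[of "ereal _" "ereal _"])
  have "norm (eval_fps F v) \<le> (\<Sum>n. norm (fps_nth F n * v ^ n))"
    unfolding eval_fps_def using S[OF v] by (rule summable_norm)
  also have "\<dots> \<le> (\<Sum>n. norm (fps_nth F n * u ^ n))"
    using S[OF v] S[of u] v
    by (intro suminf_le) (auto simp: norm_mult norm_power intro!: mult_left_mono power_mono)
  finally show ?thesis .
qed

text \<open>The n-th term is dominated by |F_n u^n| B, whose integrals are summable because the
  total mass is finite. The weight \<open>h\<close> allows two uses: with the other boundary
  function as weight, and with a power of an exponential.\<close>

lemma (in finite_measure) sums_integral_eval_fps: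
  fixes F :: "complex fps" and \<phi> h :: "'a \<Rightarrow> complex"
  assumes u: "norm u < fps_conv_radius F"
    and [measurable]: "\<phi> \<in> borel_measurable M" "h \<in> borel_measurable M"
    and \<phi>: "\<And>x. x \<in> space M \<Longrightarrow> norm (\<phi> x) \<le> 1"
    and h: "\<And>x. x \<in> space M \<Longrightarrow> norm (h x) \<le> B" and B: "0 \<le> B"
  shows "(\<lambda>n. fps_nth F n * (LINT x|M. \<phi> x ^ n * h x) * u ^ n) sums
           (LINT x|M. eval_fps F (u * \<phi> x) * h x)"
proof -
  let ?t = "\<lambda>n x. fps_nth F n * u ^ n * (\<phi> x ^ n * h x)"
  have S: "summable (\<lambda>n. norm (fps_nth F n * u ^ n))"
    using u by (intro abs_summable_in_conv_radius) (auto simp: fps_conv_radius_def)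
  have "norm (\<phi> x ^ n * h x) \<le> 1 * B" if "x \<in> space M" for x n
    unfolding norm_mult norm_power using \<phi>[OF that] h[OF that] B
    by (intro mult_mono power_le_one) auto
  then have bd: "norm (?t n x) \<le> norm (fps_nth F n * u ^ n) * B" if "x \<in> space M" for x n
    unfolding norm_mult[of "fps_nth F n * u ^ n"] using that by (intro mult_left_mono) auto
  have int: "integrable M (?t n)" for n
    by (rule integrable_const_bound[where B="norm (fps_nth F n * u ^ n) * B"]) (use bd in auto)
  have sum: "summable (\<lambda>n. norm (?t n x))" if "x \<in> space M" for x
    using S bd[OF that] by (intro summable_comparison_test'[OF summable_mult2[OF S]]) auto
  have "(\<lambda>n. LINT x|M. ?t n x) sums (LINT x|M. (\<Sum>n. ?t n x))"
  proof (rule sums_integral[OF int])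
    show "AE x in M. summable (\<lambda>n. norm (?t n x))"
      using sum by auto
    have "(LINT x|M. norm (?t n x)) \<le> (LINT x|M. norm (fps_nth F n * u ^ n) * B)" for n
      using bd by (intro integral_mono' integrable_const) (auto intro!: mult_nonneg_nonneg B)
    then have le: "(LINT x|M. norm (?t n x)) \<le> norm (fps_nth F n * u ^ n) * (B * measure M (space M))" for n
      by (simp add: mult_ac)
    show "summable (\<lambda>n. LINT x|M. norm (?t n x))"
    proof (rule summable_comparison_test'[OF summable_mult2[OF S], where N=0])
      fix n :: nat
      show "norm (LINT x|M. norm (?t n x)) \<le> norm (fps_nth F n * u ^ n) * (B * measure M (space M))"
        using le[of n] by simp
    qed
  qed
  moreover have "(LINT x|M. (\<Sum>n. ?t n x)) = (LINT x|M. eval_fps F (u * \<phi> x) * h x)"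
  proof (rule Bochner_Integration.integral_cong[OF refl])
    fix x assume x: "x \<in> space M"
    have "norm (u * \<phi> x) \<le> norm u * 1"
      unfolding norm_mult using \<phi>[OF x] by (intro mult_left_mono) auto
    then have "summable (\<lambda>n. fps_nth F n * (u * \<phi> x) ^ n)"
      using u by (intro summable_fps) (auto intro: le_less_trans[of "ereal _" "ereal _"])
    from suminf_mult2[OF this, of "h x"]
    show "(\<Sum>n. ?t n x) = eval_fps F (u * \<phi> x) * h x"
      by (simp add: eval_fps_def power_mult_distrib mult_ac)
  qed
  moreover have "(LINT x|M. ?t n x) = fps_nth F n * (LINT x|M. \<phi> x ^ n * h x) * u ^ n" for n
    by (subst integral_mult_right_zero) (simp add: mult_ac)
  ultimately show ?thesis by (simp only:)
qed

subsection \<open>The space \<open>L\<^sup>2(\<mu>)\<close>\<close>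

lemma L2_norm_nonneg: "0 \<le> L2_norm \<mu> f"
  by (simp add: L2_norm_def)

text \<open>The factor 2 comes from 2ab \<le> a^2 + b^2. Integrating this pointwise bound does the
  work of Minkowski's inequality below.\<close>

lemma cmod_diff_square_le: "(cmod (a - b))\<^sup>2 \<le> 2 * (cmod a)\<^sup>2 + 2 * (cmod b)\<^sup>2"
proof -
  have "(cmod (a - b))\<^sup>2 \<le> (cmod a + cmod b)\<^sup>2"
    by (intro power_mono norm_triangle_ineq4) auto
  also have "\<dots> \<le> 2 * (cmod a)\<^sup>2 + 2 * (cmod b)\<^sup>2"
    using sum_squares_bound[of "cmod a" "cmod b"] by (simp add: power2_sum)
  finally show ?thesis .
qed

lemma L2_space_diff:
  assumes "f \<in> L2_space \<mu>" "g \<in> L2_space \<mu>"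
  shows "(\<lambda>x. f x - g x) \<in> L2_space \<mu>"
proof -
  have [measurable]: "f \<in> borel_measurable \<mu>" "g \<in> borel_measurable \<mu>"
    using assms by (auto simp: L2_space_def)
  have "integrable \<mu> (\<lambda>x. 2 * (cmod (f x))\<^sup>2 + 2 * (cmod (g x))\<^sup>2)"
    using assms by (auto simp: L2_space_def)
  then have "integrable \<mu> (\<lambda>x. (cmod (f x - g x))\<^sup>2)"
    by (rule Bochner_Integration.integrable_bound) (auto simp: cmod_diff_square_le)
  then show ?thesis by (auto simp: L2_space_def)
qed

lemma L2_norm_diff_square_le:
  assumes "f \<in> L2_space \<mu>" "g \<in> L2_space \<mu>"
  shows "(L2_norm \<mu> (\<lambda>x. f x - g x))\<^sup>2 \<le> 2 * (L2_norm \<mu> f)\<^sup>2 + 2 * (L2_norm \<mu> g)\<^sup>2"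
proof -
  have "(LINT x|\<mu>. (cmod (f x - g x))\<^sup>2) \<le> (LINT x|\<mu>. 2 * (cmod (f x))\<^sup>2 + 2 * (cmod (g x))\<^sup>2)"
    using assms L2_space_diff[OF assms]
    by (intro integral_mono) (auto simp: L2_space_def cmod_diff_square_le)
  then show ?thesis
    using assms by (simp add: L2_norm_def L2_space_def)
qed

lemma L2_limit_AE_unique:
  assumes f: "f \<in> L2_space \<mu>" and g: "g \<in> L2_space \<mu>" and h: "\<forall>\<^sub>F r in F. h r \<in> L2_space \<mu>"
    and fh: "((\<lambda>r. L2_norm \<mu> (\<lambda>x. f x - h r x)) \<longlongrightarrow> 0) F"
    and gh: "((\<lambda>r. L2_norm \<mu> (\<lambda>x. g x - h r x)) \<longlongrightarrow> 0) F"
    and F: "F \<noteq> bot"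
  shows "AE x in \<mu>. f x = g x"
proof -
  have "((\<lambda>r. 2 * (L2_norm \<mu> (\<lambda>x. f x - h r x))\<^sup>2 + 2 * (L2_norm \<mu> (\<lambda>x. g x - h r x))\<^sup>2)
          \<longlongrightarrow> 2 * 0\<^sup>2 + 2 * 0\<^sup>2) F"
    by (intro tendsto_intros fh gh)
  moreover have "\<forall>\<^sub>F r in F. (L2_norm \<mu> (\<lambda>x. f x - g x))\<^sup>2 \<le>
      2 * (L2_norm \<mu> (\<lambda>x. f x - h r x))\<^sup>2 + 2 * (L2_norm \<mu> (\<lambda>x. g x - h r x))\<^sup>2"
    using h
  proof eventually_elim
    case (elim r)
    \<comment> \<open>The approximant cancels: (f - h r) - (g - h r) = f - g.\<close>
    from L2_norm_diff_square_le[OF L2_space_diff[OF f elim] L2_space_diff[OF g elim]]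
    show ?case by simp
  qed
  ultimately have "(L2_norm \<mu> (\<lambda>x. f x - g x))\<^sup>2 \<le> 2 * 0\<^sup>2 + 2 * 0\<^sup>2"
    by (rule tendsto_lowerbound[OF _ _ F])
  then have "(LINT x|\<mu>. (cmod (f x - g x))\<^sup>2) = 0"
    by (simp add: L2_norm_def order_antisym)
  \<comment> \<open>Integrability, supplied by \<open>L2_space_diff\<close>, matters here: a Bochner
    integral may also vanish by default.\<close>
  then have "AE x in \<mu>. (cmod (f x - g x))\<^sup>2 = 0"
    using L2_space_diff[OF f g] by (subst (asm) integral_nonneg_eq_0_iff_AE) (auto simp: L2_space_def)
  then show ?thesis by simp
qed

text \<open>The integrands below are functions on the whole line, while the measure of the theorem
  lives on the Borel sets of [0,1). The assumption records the link between the two: continuous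
  functions are measurable.\<close>

locale borel_prob = prob_space \<mu> for \<mu> :: "real measure" +
  assumes borel_measurable_continuous:
    "\<And>f :: real \<Rightarrow> complex. continuous_on UNIV f \<Longrightarrow> f \<in> borel_measurable \<mu>"
begin

lemma L2_space_bounded:
  assumes [measurable]: "f \<in> borel_measurable \<mu>" and f: "\<And>x. x \<in> space \<mu> \<Longrightarrow> cmod (f x) \<le> B"
  shows "f \<in> L2_space \<mu>"
proof -
  have "integrable \<mu> (\<lambda>x. (cmod (f x))\<^sup>2)"
    by (rule integrable_const_bound[where B="B\<^sup>2"]) (use f in \<open>auto intro!: power_mono\<close>)
  then show ?thesis by (auto simp: L2_space_def)
qed

lemma L2_norm_le:
  assumes f: "\<And>x. x \<in> space \<mu> \<Longrightarrow> cmod (f x) \<le> B" and B: "0 \<le> B"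
  shows "L2_norm \<mu> f \<le> B"
proof -
  have "(LINT x|\<mu>. (cmod (f x))\<^sup>2) \<le> (LINT x|\<mu>. B\<^sup>2)"
    \<comment> \<open>Integrability is asked of the majorant only; a non-integrable left side has
      integral 0 by default, which respects the bound too.\<close>
    using f by (intro integral_mono') (auto intro!: power_mono)
  then show ?thesis
    using B by (auto simp: L2_norm_def prob_space intro: real_le_lsqrt)
qed

text \<open>Total mass one makes the supremum norm dominate the L^2 norm. The filter is general so
  as to cover partial sums as well as radial limits.\<close>

lemma L2_limit_of_uniform_limit:
  assumes "uniform_limit (space \<mu>) f g F"
  shows "((\<lambda>i. L2_norm \<mu> (\<lambda>x. g x - f i x)) \<longlongrightarrow> 0) F"
proof (rule tendstoI)
  fix e :: real assume e: "0 < e"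
  then have "\<forall>\<^sub>F i in F. \<forall>x\<in>space \<mu>. dist (f i x) (g x) < e/2"
    by (intro uniform_limitD[OF assms]) auto
  then show "\<forall>\<^sub>F i in F. dist (L2_norm \<mu> (\<lambda>x. g x - f i x)) 0 < e"
  proof eventually_elim
    case (elim i)
    have "L2_norm \<mu> (\<lambda>x. g x - f i x) \<le> e/2"
      using elim e by (intro L2_norm_le) (auto simp: dist_norm norm_minus_commute less_imp_le)
    then show ?case using e L2_norm_nonneg[of \<mu> "\<lambda>x. g x - f i x"] by simp
  qed
qed

section \<open>Boundary values of power series on the circle\<close>

lemma eval_fps_circle_L2:
  fixes F :: "complex fps"
  assumes u: "norm u < fps_conv_radius F"
  shows "(\<lambda>x. eval_fps F (u * cis (2 * pi * x))) \<in> L2_space \<mu>"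
proof (rule L2_space_bounded)
  have "continuous_on UNIV (\<lambda>x. cis (2 * pi * x))"
    by (intro continuous_intros)
  then show "(\<lambda>x. eval_fps F (u * cis (2 * pi * x))) \<in> borel_measurable \<mu>"
    using u by (intro borel_measurable_continuous continuous_on_eval_fps' continuous_intros)
      (auto simp: norm_mult in_eball_iff)
  show "cmod (eval_fps F (u * cis (2 * pi * x))) \<le> (\<Sum>n. norm (fps_nth F n * u ^ n))" for x
    by (rule norm_eval_fps_le[OF u]) (simp add: norm_mult)
qed

text \<open>The exponentials are unimodular, so the Weierstrass M-test with majorant |F_n u^n| gives
  uniform convergence, hence convergence in L^2. With u the conjugate of w this is the first
  claim.\<close>

lemma L2_summable_fps_circle:
  fixes F :: "complex fps"
  assumes u: "norm u < fps_conv_radius F"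
  shows "L2_summable \<mu> (\<lambda>n x. fps_nth F n * u ^ n * cis (2 * pi * real n * x))"
    (is "L2_summable \<mu> ?t")
  unfolding L2_summable_def
proof (intro conjI allI bexI[OF _ eval_fps_circle_L2[OF u]])
  have t: "?t n x = fps_nth F n * (u * cis (2 * pi * x)) ^ n" for n x
    by (simp add: power_mult_distrib Complex.DeMoivre mult_ac)
  have n: "norm (?t n x) \<le> norm (fps_nth F n * u ^ n)" for n x
    by (simp add: norm_mult)
  have "continuous_on UNIV (?t n)" for n
    by (intro continuous_intros)
  then show "?t n \<in> L2_space \<mu>" for n
    using n by (rule L2_space_bounded[OF borel_measurable_continuous])
  have "summable (\<lambda>n. norm (fps_nth F n * u ^ n))"
    using u by (intro abs_summable_in_conv_radius) (auto simp: fps_conv_radius_def)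
  then have "uniform_limit (space \<mu>) (\<lambda>N x. \<Sum>n<N. ?t n x) (\<lambda>x. \<Sum>n. ?t n x) sequentially"
    by (rule Weierstrass_m_test[OF n])
  then have "uniform_limit (space \<mu>) (\<lambda>N x. \<Sum>n<N. ?t n x)
      (\<lambda>x. eval_fps F (u * cis (2 * pi * x))) sequentially"
    by (simp add: t eval_fps_def)
  then show "(\<lambda>N. L2_norm \<mu> (\<lambda>x. eval_fps F (u * cis (2 * pi * x)) - (\<Sum>n<N. ?t n x)))
      \<longlonglongrightarrow> 0"
    by (rule L2_limit_of_uniform_limit)
qed

lemma is_L2_boundary_eval_fps:
  fixes F :: "complex fps"
  assumes u: "norm u < fps_conv_radius F"
  shows "is_L2_boundary \<mu> (\<lambda>z. eval_fps F (u * z)) (\<lambda>x. eval_fps F (u * cis (2 * pi * x)))"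
  unfolding is_L2_boundary_def
proof (intro conjI eval_fps_circle_L2 u)
  have "eval_fps F \<circ> (\<lambda>z. u * z) holomorphic_on ball 0 1"
  proof (rule holomorphic_on_compose[OF _ holomorphic_on_eval_fps])
    show "(\<lambda>z. u * z) holomorphic_on ball 0 1" by (intro holomorphic_intros)
    have "ereal (norm (u * z)) < fps_conv_radius F" if "norm z < 1" for z
    proof (rule le_less_trans[OF _ u])
      have "norm (u * z) \<le> norm u * 1"
        unfolding norm_mult using that by (intro mult_left_mono) auto
      then show "ereal (norm (u * z)) \<le> ereal (norm u)" by simp
    qed
    then show "(\<lambda>z. u * z) ` ball 0 1 \<subseteq> eball 0 (fps_conv_radius F)"
      by (auto simp: in_eball_iff)
  qed
  then show "(\<lambda>z. eval_fps F (u * z)) holomorphic_on ball 0 1" by (simp add: o_def)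
  show "((\<lambda>r. L2_norm \<mu> (\<lambda>x. eval_fps F (u * cis (2 * pi * x)) -
      eval_fps F (u * (complex_of_real r * cis (2 * pi * x))))) \<longlongrightarrow> 0) (at_left 1)"
    by (intro L2_limit_of_uniform_limit uniform_limit_eval_fps_radial u) auto
qed

text \<open>Both functions are L^2 limits of the same radial dilates. The dilates lie in
  \<open>L2_space \<mu>\<close> for r in (0,1), since k is continuous and therefore bounded on the
  compact disc of radius r.\<close>

lemma is_L2_boundary_AE_unique:
  assumes f: "is_L2_boundary \<mu> k f" and g: "is_L2_boundary \<mu> k g"
  shows "AE x in \<mu>. f x = g x"
proof (rule L2_limit_AE_unique)
  show "f \<in> L2_space \<mu>" "g \<in> L2_space \<mu>"
    and "((\<lambda>r. L2_norm \<mu> (\<lambda>x. f x - k (complex_of_real r * cis (2 * pi * x)))) \<longlongrightarrow> 0) (at_left 1)"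
    and "((\<lambda>r. L2_norm \<mu> (\<lambda>x. g x - k (complex_of_real r * cis (2 * pi * x)))) \<longlongrightarrow> 0) (at_left 1)"
    using f g by (auto simp: is_L2_boundary_def)
  have k: "continuous_on (ball 0 1) k"
    using f by (auto simp: is_L2_boundary_def intro: holomorphic_on_imp_continuous_on)
  have "\<forall>\<^sub>F r in at_left (1::real). r \<in> {0<..<1}"
    by (rule eventually_at_left_real) auto
  then show "\<forall>\<^sub>F r in at_left 1. (\<lambda>x. k (complex_of_real r * cis (2 * pi * x))) \<in> L2_space \<mu>"
  proof eventually_elim
    case (elim r)
    have "bounded (k ` cball 0 r)"
      using elim
      by (intro compact_imp_bounded compact_continuous_image continuous_on_subset[OF k]) auto
    then obtain B where B: "\<And>z. z \<in> cball 0 r \<Longrightarrow> norm (k z) \<le> B"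
      unfolding bounded_iff by blast
    have "continuous_on UNIV (\<lambda>x. k (complex_of_real r * cis (2 * pi * x)))"
      using elim by (intro continuous_on_compose2[OF k] continuous_intros) (auto simp: norm_mult)
    then show ?case
      using elim by (intro L2_space_bounded[OF borel_measurable_continuous, where B=B] B)
        (auto simp: norm_mult)
  qed
qed simp

text \<open>Trades the existential family in \<open>reproduces_itself\<close> for an explicitly
  known one: boundaries agree almost everywhere, so the integrals coincide.\<close>

lemma reproduces_itself_iff:
  assumes K: "\<And>w. w \<in> ball 0 1 \<Longrightarrow> is_L2_boundary \<mu> (K w) (Ks w)"
  shows "reproduces_itself \<mu> K \<longleftrightarrow>
    (\<forall>w \<in> ball 0 1. \<forall>z \<in> ball 0 1. K w z = (LINT x|\<mu>. Ks w x * cnj (Ks z x)))" (is "_ \<longleftrightarrow> ?R")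
proof
  assume "reproduces_itself \<mu> K"
  then obtain Ls where L: "\<And>w. w \<in> ball 0 1 \<Longrightarrow> is_L2_boundary \<mu> (K w) (Ls w)"
    and int: "\<And>w z. w \<in> ball 0 1 \<Longrightarrow> z \<in> ball 0 1 \<Longrightarrow> K w z = (LINT x|\<mu>. Ls w x * cnj (Ls z x))"
    unfolding reproduces_itself_def by blast
  show ?R
  proof (intro ballI)
    fix w z :: complex assume wz: "w \<in> ball 0 1" "z \<in> ball 0 1"
    have "f \<in> borel_measurable \<mu>" if "is_L2_boundary \<mu> k f" for k f
      using that by (simp add: is_L2_boundary_def L2_space_def)
    note [measurable] = this[OF L[OF wz(1)]] this[OF L[OF wz(2)]]
      this[OF K[OF wz(1)]] this[OF K[OF wz(2)]]
    have [measurable]: "cnj \<in> borel_measurable borel"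
      by (intro borel_measurable_continuous_onI continuous_intros)
    have "AE x in \<mu>. Ls w x * cnj (Ls z x) = Ks w x * cnj (Ks z x)"
      using is_L2_boundary_AE_unique[OF L[OF wz(1)] K[OF wz(1)]]
        is_L2_boundary_AE_unique[OF L[OF wz(2)] K[OF wz(2)]]
      by eventually_elim simp
    then show "K w z = (LINT x|\<mu>. Ks w x * cnj (Ks z x))"
      unfolding int[OF wz] by (intro integral_cong_AE) measurable
  qed
next
  assume ?R
  then show "reproduces_itself \<mu> K"
    using K unfolding reproduces_itself_def by blast
qed

section \<open>The Gram matrix of the exponentials and the reproducing identity\<close>

lemma fourier_matrix_eq:
  "fourier_matrix \<mu> m n = (LINT x|\<mu>. cis (2 * pi * x) ^ m * cis (- 2 * pi * x) ^ n)"
proof -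
  \<comment> \<open>The entry is thus the inner product of the m-th and n-th exponentials, the
    second one conjugated.\<close>
  have "cis (2 * pi * x) ^ m * cis (- 2 * pi * x) ^ n = cis (- 2 * pi * of_int (int n - int m) * x)" for x
    unfolding Complex.DeMoivre cis_mult by (rule arg_cong[where f=cis]) (simp add: algebra_simps)
  then show ?thesis
    by (simp only: fourier_matrix_def fourier_coeff_def)
qed

text \<open>Expands only the factor in v, with the bounded factor in u as weight. The result is a
  power series in v whose coefficients are integrals still depending on u.\<close>

lemma sums_inner_circle_outer:
  fixes F :: "complex fps"
  assumes u: "norm u < fps_conv_radius F" and v: "norm v < fps_conv_radius F"
  shows
    "(\<lambda>n. fps_nth F n * (LINT x|\<mu>. cis (- 2 * pi * x) ^ n * eval_fps F (u * cis (2 * pi * x))) * v ^ n)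
       sums (LINT x|\<mu>. eval_fps F (v * cis (- 2 * pi * x)) * eval_fps F (u * cis (2 * pi * x)))"
proof -
  have meas: "(\<lambda>x. cis (- 2 * pi * x)) \<in> borel_measurable \<mu>"
    by (intro borel_measurable_continuous continuous_intros)
  have bd: "cmod (eval_fps F (u * cis (2 * pi * x))) \<le> (\<Sum>n. norm (fps_nth F n * u ^ n))" for x
    by (rule norm_eval_fps_le[OF u]) (simp add: norm_mult)
  show ?thesis
    using eval_fps_circle_L2[OF u] bd order_trans[OF norm_ge_zero bd]
    by (intro sums_integral_eval_fps[OF v meas]) (auto simp: L2_space_def)
qed

text \<open>Expands the remaining factor, with the unimodular n-th power as weight, so that the
  coefficients become entries of M.\<close>

lemma sums_inner_circle_inner:
  fixes F :: "complex fps"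
  assumes u: "norm u < fps_conv_radius F"
  shows "(\<lambda>m. fps_nth F m * fourier_matrix \<mu> m n * u ^ m)
    sums (LINT x|\<mu>. cis (- 2 * pi * x) ^ n * eval_fps F (u * cis (2 * pi * x)))"
proof -
  have meas: "(\<lambda>x. cis (c * x)) \<in> borel_measurable \<mu>" for c
    by (intro borel_measurable_continuous continuous_intros)
  have "(\<lambda>m. fps_nth F m * (LINT x|\<mu>. cis (2 * pi * x) ^ m * cis (- 2 * pi * x) ^ n) * u ^ m)
         sums (LINT x|\<mu>. eval_fps F (u * cis (2 * pi * x)) * cis (- 2 * pi * x) ^ n)"
    by (rule sums_integral_eval_fps[OF u meas borel_measurable_power[OF meas], where B=1])
      (auto simp: norm_power)
  then show ?thesis
    by (simp add: fourier_matrix_eq mult.commute)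
qed

text \<open>The right-hand side is CMC = C, read entry by entry, for the diagonal matrix C of the
  coefficients of \<open>F\<close>.\<close>

lemma reproduces_itself_eval_fps_iff:
  fixes F :: "complex fps"
  assumes F: "1 \<le> fps_conv_radius F" and real: "\<And>n. fps_nth F n \<in> \<real>"
  shows "reproduces_itself \<mu> (\<lambda>w z. eval_fps F (cnj w * z)) \<longleftrightarrow>
    (\<forall>m n. fps_nth F m * fourier_matrix \<mu> m n * fps_nth F n = (if m = n then fps_nth F n else 0))"
    (is "_ \<longleftrightarrow> ?R")
proof -
  let ?P = "\<lambda>u n. LINT x|\<mu>. cis (- 2 * pi * x) ^ n * eval_fps F (u * cis (2 * pi * x))"
  have rad: "norm u < fps_conv_radius F" if "norm u < 1" for u :: complex
    by (rule less_le_trans[OF _ F]) (use that in simp)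
  \<comment> \<open>Real coefficients let conjugation pass to the argument, so the conjugated
    boundary is again a power series.\<close>
  have cnj: "cnj (eval_fps F v) = eval_fps F (cnj v)" if "norm v < 1" for v
  proof -
    have "(\<lambda>n. cnj (fps_nth F n * v ^ n)) sums cnj (eval_fps F v)"
      using sums_eval_fps[OF rad[OF that]] by (simp only: sums_cnj)
    moreover have "cnj (fps_nth F n * v ^ n) = fps_nth F n * cnj v ^ n" for n
      using real[of n] by (simp add: Reals_cnj_iff)
    ultimately have "(\<lambda>n. fps_nth F n * cnj v ^ n) sums cnj (eval_fps F v)"
      by (simp only:)
    then show ?thesis
      unfolding eval_fps_def[of F "cnj v"] by (rule sums_unique)
  qed
  have "reproduces_itself \<mu> (\<lambda>w z. eval_fps F (cnj w * z)) \<longleftrightarrow>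
    (\<forall>w \<in> ball 0 1. \<forall>z \<in> ball 0 1. eval_fps F (cnj w * z) =
      (LINT x|\<mu>. eval_fps F (cnj w * cis (2 * pi * x)) * cnj (eval_fps F (cnj z * cis (2 * pi * x)))))"
    by (rule reproduces_itself_iff[OF is_L2_boundary_eval_fps[OF rad]]) simp
  \<comment> \<open>Substituting u for the conjugate of w turns both sides into power series in u
    and z without conjugates of these variables.\<close>
  also have "\<dots> \<longleftrightarrow> (\<forall>u. norm u < 1 \<longrightarrow> (\<forall>z. norm z < 1 \<longrightarrow> eval_fps F (u * z) =
      (LINT x|\<mu>. eval_fps F (z * cis (- 2 * pi * x)) * eval_fps F (u * cis (2 * pi * x)))))"
    (is "?L \<longleftrightarrow> ?L'")
  proof
    assume L: ?L
    show ?L'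
    proof (intro allI impI)
      fix u z :: complex assume "norm u < 1" "norm z < 1"
      then show "eval_fps F (u * z) =
        (LINT x|\<mu>. eval_fps F (z * cis (- 2 * pi * x)) * eval_fps F (u * cis (2 * pi * x)))"
        using L[rule_format, of "cnj u" z] by (simp add: cnj norm_mult cis_cnj mult.commute)
    qed
  next
    assume L: ?L'
    show ?L
    proof (intro ballI)
      fix w z :: complex assume "w \<in> ball 0 1" "z \<in> ball 0 1"
      then show "eval_fps F (cnj w * z) =
        (LINT x|\<mu>. eval_fps F (cnj w * cis (2 * pi * x)) * cnj (eval_fps F (cnj z * cis (2 * pi * x))))"
        using L[rule_format, of "cnj w" z] by (simp add: cnj norm_mult cis_cnj mult.commute)
    qed
  qed
  \<comment> \<open>Compare coefficients of z^n for fixed u. The factor \<open>fps_nth F n\<close>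
    stays on both sides because it may vanish.\<close>
  also have "\<dots> \<longleftrightarrow> (\<forall>u. norm u < 1 \<longrightarrow> (\<forall>n. fps_nth F n * ?P u n = fps_nth F n * u ^ n))"
  proof (intro all_cong1 imp_cong[OF refl])
    fix u :: complex assume u: "norm u < 1"
    let ?I = "\<lambda>z. LINT x|\<mu>. eval_fps F (z * cis (- 2 * pi * x)) * eval_fps F (u * cis (2 * pi * x))"
    have 1: "(\<lambda>n. fps_nth F n * ?P u n * z ^ n) sums ?I z" if "norm z < 1" for z
      by (intro sums_inner_circle_outer rad u that)
    have 2: "(\<lambda>n. fps_nth F n * u ^ n * z ^ n) sums eval_fps F (u * z)" if "norm z < 1" for z
    proof -
      have "norm (u * z) < 1"
        using u that mult_strict_mono'[of "norm u" 1 "norm z" 1] by (simp add: norm_mult)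
      from sums_eval_fps[OF rad[OF this]] show ?thesis
        by (simp add: power_mult_distrib mult.assoc)
    qed
    show "(\<forall>z. norm z < 1 \<longrightarrow> eval_fps F (u * z) = ?I z) \<longleftrightarrow>
        (\<forall>n. fps_nth F n * ?P u n = fps_nth F n * u ^ n)"
    proof
      assume L: "\<forall>z. norm z < 1 \<longrightarrow> eval_fps F (u * z) = ?I z"
      have "(\<lambda>n. fps_nth F n * ?P u n) = (\<lambda>n. fps_nth F n * u ^ n)"
      proof (rule powser_coeff_unique[OF zero_less_one 1])
        show "(\<lambda>n. fps_nth F n * u ^ n * z ^ n) sums ?I z" if "norm z < 1" for z
          using 2[OF that] L that by (simp only:)
      qed
      then show "\<forall>n. fps_nth F n * ?P u n = fps_nth F n * u ^ n"
        unfolding fun_eq_iff .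
    next
      assume R: "\<forall>n. fps_nth F n * ?P u n = fps_nth F n * u ^ n"
      show "\<forall>z. norm z < 1 \<longrightarrow> eval_fps F (u * z) = ?I z"
      proof (intro allI impI)
        fix z :: complex assume z: "norm z < 1"
        from 1[OF z] have "(\<lambda>n. fps_nth F n * u ^ n * z ^ n) sums ?I z"
          by (simp only: R)
        with 2[OF z] show "eval_fps F (u * z) = ?I z"
          by (rule sums_unique2)
      qed
    qed
  qed
  \<comment> \<open>Compare coefficients of u^m for fixed n: they are the entries of CMC and of
    C.\<close>
  also have "\<dots> \<longleftrightarrow> ?R"
  proof -
    let ?D = "\<lambda>m n. fps_nth F m * fourier_matrix \<mu> m n * fps_nth F n"
    let ?C = "\<lambda>m n. if m = n then fps_nth F n else 0"
    have 1: "(\<lambda>m. ?D m n * u ^ m) sums (fps_nth F n * ?P u n)" if "norm u < 1" for u n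
    proof -
      have "?D m n * u ^ m = fps_nth F n * (fps_nth F m * fourier_matrix \<mu> m n * u ^ m)" for m
        by (simp only: mult_ac)
      then show ?thesis
        using sums_mult[OF sums_inner_circle_inner[OF rad[OF that]], of "fps_nth F n" n]
        by (simp only:)
    qed
    have 2: "(\<lambda>m. ?C m n * u ^ m) sums (fps_nth F n * u ^ n)" for u n
    proof -
      have "?C m n * u ^ m = (if m = n then fps_nth F n * u ^ m else 0)" for m
        by simp
      then show ?thesis
        using sums_single[of n "\<lambda>m. fps_nth F n * u ^ m"] by (simp only:)
    qed
    show ?thesis
    proof
      assume L: "\<forall>u. norm u < 1 \<longrightarrow> (\<forall>n. fps_nth F n * ?P u n = fps_nth F n * u ^ n)"
      have eq: "(\<lambda>m. ?D m n) = (\<lambda>m. ?C m n)" for n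
      proof (rule powser_coeff_unique[OF zero_less_one 1])
        show "(\<lambda>m. ?C m n * u ^ m) sums (fps_nth F n * ?P u n)" if "norm u < 1" for u
          using 2[of n u] L that by (simp only:)
      qed
      show ?R
        using eq[unfolded fun_eq_iff] by blast
    next
      assume R: ?R
      show "\<forall>u. norm u < 1 \<longrightarrow> (\<forall>n. fps_nth F n * ?P u n = fps_nth F n * u ^ n)"
      proof (intro allI impI)
        fix u :: complex and n assume u: "norm u < 1"
        from 1[OF u] have "(\<lambda>m. ?C m n * u ^ m) sums (fps_nth F n * ?P u n)"
          by (simp only: R)
        then show "fps_nth F n * ?P u n = fps_nth F n * u ^ n"
          using 2 by (rule sums_unique2)
      qed
    qed
  qed
  finally show ?thesis .
qed

end

lemma prob_space_imp_borel_prob: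
  assumes "prob_space \<mu>" "sets \<mu> = sets (restrict_space borel A)"
  shows "borel_prob \<mu>"
proof -
  interpret prob_space \<mu> by fact
  show ?thesis
  proof
    fix f :: "real \<Rightarrow> complex" assume "continuous_on UNIV f"
    then have "f \<in> borel_measurable (restrict_space borel A)"
      by (intro measurable_restrict_space1 borel_measurable_continuous_onI)
    then show "f \<in> borel_measurable \<mu>"
      by (simp only: measurable_cong_sets[OF assms(2) refl])
  qed
qed

subsection \<open>Diagonal matrices\<close>

text \<open>Only the term k = m survives. Stated with \<open>sums\<close>, this yields both the
  convergence required by \<open>prod_defined\<close> and the value of
  \<open>matrix_prod\<close>.\<close>

lemma sums_diagonal_left:
  assumes "diagonal_matrix C"
  shows "(\<lambda>k. C m k * B k) sums (C m m * B m)"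
  using sums_single[of m "\<lambda>k. C m k * B k"] assms
  by (auto simp: diagonal_matrix_def elim!: back_subst[of "\<lambda>f. f sums _"])

lemma sums_diagonal_right:
  assumes "diagonal_matrix C"
  shows "(\<lambda>k. B k * C k n) sums (B n * C n n)"
  using sums_single[of n "\<lambda>k. B k * C k n"] assms
  by (auto simp: diagonal_matrix_def elim!: back_subst[of "\<lambda>f. f sums _"])

lemma matrix_prod_diagonal_left:
  "diagonal_matrix C \<Longrightarrow> matrix_prod C A m n = C m m * A m n"
  unfolding matrix_prod_def by (intro sums_unique[symmetric] sums_diagonal_left)

lemma matrix_prod_diagonal_right:
  "diagonal_matrix C \<Longrightarrow> matrix_prod A C m n = A m n * C n n"
  unfolding matrix_prod_def by (intro sums_unique[symmetric] sums_diagonal_right)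

text \<open>Every sum involved has at most one nonzero term, and both bracketings have the entries
  \<open>C m m * A m n * D n n\<close>.\<close>

lemma triple_prod_defined_diagonal:
  assumes "diagonal_matrix C" "diagonal_matrix D"
  shows "triple_prod_defined C A D"
  unfolding triple_prod_defined_def prod_defined_def
  using sums_diagonal_left[OF assms(1), THEN sums_summable]
    sums_diagonal_right[OF assms(2), THEN sums_summable]
  by (simp add: fun_eq_iff matrix_prod_diagonal_left[OF assms(1)]
      matrix_prod_diagonal_right[OF assms(2)])

lemma matrix_kernel_diagonal:
  assumes "diagonal_matrix C"
  shows "matrix_kernel C w z = eval_fps (Abs_fps (\<lambda>n. C n n)) (cnj w * z)"
proof -
  have "(\<Sum>m. C m n * cnj w ^ m * z ^ n) = C n n * (cnj w * z) ^ n" for n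
    using sums_unique[OF sums_diagonal_right[OF assms, of "\<lambda>m. cnj w ^ m * z ^ n" n]]
    by (simp add: power_mult_distrib mult_ac)
  then show ?thesis by (simp add: matrix_kernel_def eval_fps_def)
qed

theorem theorem3p2:
  fixes C :: "nat \<Rightarrow> nat \<Rightarrow> complex" and \<mu> :: "real measure"
  assumes "diagonal_matrix C"
    and "\<And>n. C n n \<in> \<real>\<^sub>\<ge>\<^sub>0"
    and "\<And>r::real. 0 < r \<Longrightarrow> r < 1 \<Longrightarrow> summable (\<lambda>n. C n n * complex_of_real r ^ n)"
    and "prob_space \<mu>"
    and "sets \<mu> = sets (restrict_space borel {0..<1})"
  shows "(\<forall>w \<in> ball 0 1.
            L2_summable \<mu> (\<lambda>n x. C n n * cnj w ^ n * cis (2 * pi * real n * x)))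
       \<and> triple_prod_defined C (fourier_matrix \<mu>) C
       \<and> (reproduces_itself \<mu> (matrix_kernel C) \<longleftrightarrow>
            C = matrix_prod (matrix_prod C (fourier_matrix \<mu>)) C)"
proof -
  interpret borel_prob \<mu> by (rule prob_space_imp_borel_prob[OF assms(4,5)])
  define F where "F = Abs_fps (\<lambda>n. C n n)"
  \<comment> \<open>Convergence at every real r in (0,1) forces radius of convergence at least
    1.\<close>
  have F: "1 \<le> fps_conv_radius F"
    unfolding fps_conv_radius_def F_def
    by (rule conv_radius_geI_ex') (use assms(3) in auto)
  have "L2_summable \<mu> (\<lambda>n x. C n n * cnj w ^ n * cis (2 * pi * real n * x))" if "w \<in> ball 0 1" for w
  proof -
    have "ereal (norm (cnj w)) < fps_conv_radius F"
      by (rule less_le_trans[OF _ F]) (use that in simp)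
    from L2_summable_fps_circle[OF this] show ?thesis by (simp add: F_def)
  qed
  moreover have "reproduces_itself \<mu> (matrix_kernel C) \<longleftrightarrow>
      C = matrix_prod (matrix_prod C (fourier_matrix \<mu>)) C"
  proof -
    have K: "matrix_kernel C = (\<lambda>w z. eval_fps F (cnj w * z))"
      by (intro ext) (simp add: matrix_kernel_diagonal[OF assms(1)] F_def)
    have nth: "fps_nth F n = C n n" for n
      by (simp add: F_def)
    have real: "fps_nth F n \<in> \<real>" for n
      using assms(2)[of n] by (simp add: nth complex_nonneg_Reals_iff complex_is_Real_iff)
    have "reproduces_itself \<mu> (matrix_kernel C) \<longleftrightarrow>
        (\<forall>m n. C m m * fourier_matrix \<mu> m n * C n n = (if m = n then C n n else 0))"
      unfolding K reproduces_itself_eval_fps_iff[OF F real] nth ..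
    also have "(\<forall>m n. C m m * fourier_matrix \<mu> m n * C n n = (if m = n then C n n else 0)) \<longleftrightarrow>
        C = matrix_prod (matrix_prod C (fourier_matrix \<mu>)) C"
    proof -
      have "(if m = n then C n n else 0) = C m n" for m n
        using assms(1) by (simp add: diagonal_matrix_def)
      then show ?thesis
        unfolding fun_eq_iff matrix_prod_diagonal_left[OF assms(1)]
          matrix_prod_diagonal_right[OF assms(1)] by metis
    qed
    finally show ?thesis .
  qed
  ultimately show ?thesis
    using triple_prod_defined_diagonal[OF assms(1,1)] by blast
qed

end
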